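(* Let $k<N$ be positive integers and let $p>0$. If $k=1$, or if $k>1$ and $p<\frac{k+1}{k-1}$, then there does not exist any positive viscosity supersolution of the equation $$\mathcal{P}^+_k(D^2u(x))+u^p(x)=0\quad\text{in }\mathbb{R}^N_+.$$
   Context: $\mathbb{R}^N_+=\{x=(x',x_N)\in\mathbb{R}^{N-1}\times\mathbb{R}: x_N>0\}$. For a symmetric $N\times N$ real matrix $X$ with ordered eigenvalues $\lambda_1(X)\le\cdots\le\lambda_N(X)$, set $\mathcal{P}^+_k(X)=\sum_{i=N-k+1}^N\lambda_i(X)$. A positive viscosity supersolution of the equation is a lower semicontinuous function $u:\mathbb{R}^N_+\to(0,+\infty)$ such that, for every $x_0\in\mathbb{R}^N_+$ and every $C^2$ function $\varphi$ such that $u-\varphi$ has a local minimum at $x_0$, one has $\mathcal{P}^+_k(D^2\varphi(x_0))+u(x_0)^p\le 0$. *)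

theory Defs
  imports "HOL-Analysis.Analysis" "HOL-Computational_Algebra.Computational_Algebra"
begin

text \<open>
  The space \<open>\<real>\<^sup>N\<close> is \<^typ>\<open>real ^ 'n\<close> with \<open>N = CARD('n)\<close>. A finite index type carries no
  distinguished last element, so the index of the coordinate \<open>x\<^sub>N\<close> is a parameter \<open>l :: 'n\<close>.
\<close>

definition half_space :: "'n \<Rightarrow> (real ^ 'n) set" where
  "half_space l = {x. x $ l > 0}"

definition charpoly :: "real ^ 'n ^ 'n \<Rightarrow> real poly" where
  "charpoly X = det (mat [:0, 1:] - (\<chi> i j. [:X $ i $ j:]))"

text \<open>
  The real eigenvalues of \<open>X\<close> in increasing order, repeated according to multiplicity;
  \<open>eigval X i\<close> is \<open>\<lambda>\<^sub>i(X)\<close> with \<open>i\<close> counted from \<open>1\<close>. For symmetric \<open>X\<close> the list has length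
  \<open>N\<close>; for other matrices \<open>eigval\<close> may be unspecified.
\<close>

definition eigenvalues :: "real ^ 'n ^ 'n \<Rightarrow> real list" where
  "eigenvalues X = sorted_list_of_multiset (proots (charpoly X))"

definition eigval :: "real ^ 'n ^ 'n \<Rightarrow> nat \<Rightarrow> real" where
  "eigval X i = eigenvalues X ! (i - 1)"

definition P_plus :: "nat \<Rightarrow> real ^ 'n ^ 'n \<Rightarrow> real" where
  "P_plus k X = (\<Sum>i = CARD('n) - k + 1..CARD('n). eigval X i)"

definition grad :: "(real ^ 'n \<Rightarrow> real) \<Rightarrow> real ^ 'n \<Rightarrow> real ^ 'n" where
  "grad f x = (\<chi> i. frechet_derivative f (at x) (axis i 1))"

definition hessian :: "(real ^ 'n \<Rightarrow> real) \<Rightarrow> real ^ 'n \<Rightarrow> real ^ 'n ^ 'n" where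
  "hessian f x = jacobian (grad f) (at x)"

text \<open>Meant for open \<open>S\<close> only, where \<open>at x\<close> and \<open>at x within S\<close> agree for \<open>x \<in> S\<close>.\<close>

definition C2_on :: "(real ^ 'n) set \<Rightarrow> (real ^ 'n \<Rightarrow> real) \<Rightarrow> bool" where
  "C2_on S f \<longleftrightarrow>
     (\<forall>x\<in>S. f differentiable (at x)) \<and>
     (\<forall>x\<in>S. grad f differentiable (at x)) \<and>
     continuous_on S (hessian f)"

definition lower_semicontinuous_on ::
    "'a::topological_space set \<Rightarrow> ('a \<Rightarrow> real) \<Rightarrow> bool" where
  "lower_semicontinuous_on S u \<longleftrightarrow>
     (\<forall>x\<in>S. \<forall>c < u x. \<forall>\<^sub>F y in at x within S. c < u y)"

definition local_min_on ::
    "'a::topological_space set \<Rightarrow> ('a \<Rightarrow> real) \<Rightarrow> 'a \<Rightarrow> bool" where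
  "local_min_on S f x \<longleftrightarrow> (\<forall>\<^sub>F y in at x within S. f x \<le> f y)"

text \<open>Only the values of \<open>u\<close> and of the test functions on the half-space matter.\<close>

definition positive_viscosity_supersolution ::
    "'n \<Rightarrow> nat \<Rightarrow> real \<Rightarrow> (real ^ 'n \<Rightarrow> real) \<Rightarrow> bool" where
  "positive_viscosity_supersolution l k p u \<longleftrightarrow>
     (\<forall>x\<in>half_space l. u x > 0) \<and>
     lower_semicontinuous_on (half_space l) u \<and>
     (\<forall>x\<^sub>0\<in>half_space l. \<forall>\<phi>.
        C2_on (half_space l) \<phi> \<and> local_min_on (half_space l) (\<lambda>x. u x - \<phi> x) x\<^sub>0 \<longrightarrow>
        P_plus k (hessian \<phi> x\<^sub>0) + u x\<^sub>0 powr p \<le> 0)"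

end

theory Submission
  imports Defs
begin

text \<open>
  The eigenvalue sum \<open>P_plus k X\<close> bounds the trace of \<open>X\<close> on any orthonormal \<open>k\<close>-frame from above
  (\<open>ky_fan_P_plus\<close>). A supersolution is therefore superharmonic, in the viscosity sense, along every
  \<open>k\<close>-dimensional plane, in particular along those parallel to the boundary, of which there are some
  because \<open>k < N\<close>. Such planes are entire spaces, and a positive \<open>u\<close> on them is compared with
  radial functions of the form \<open>(1 + |y|\<^sup>2 / R\<^sup>2) powr (- a / 2)\<close>. For \<open>a > k - 1\<close> such a function is
  strictly subharmonic away from a ball of radius comparable to \<open>R\<close>, so it can touch \<open>u\<close> from below
  only inside that ball.

  To obtain test functions on the open half-space, the argument \<open>|y|\<^sup>2 / R\<^sup>2\<close> is replaced by the weighted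
  square distance \<open>\<sigma>\<close> to the point \<open>axis l 1\<close>, with the small weight \<open>b = 1 / R\<^sup>2\<close> in \<open>k\<close> directions
  parallel to the boundary and a large weight \<open>c\<close> in all others, and a small constant \<open>eps\<close> is
  subtracted. For large \<open>c\<close> the function is positive only on a bounded set well inside the
  half-space. Scale it by the largest \<open>t\<close> for which it stays below \<open>u\<close>. Wherever \<open>\<sigma>\<close> is large, one of
  two frames has positive trace: the \<open>k\<close> parallel directions, or \<open>k - 1\<close> of these and the direction of
  the transversal displacement. For \<open>a > k - 1\<close> this covers all cases, uniformly in \<open>b\<close>, \<open>c\<close>
  and \<open>eps\<close>, so touching takes place where \<open>\<sigma>\<close> is bounded. There the equation
  gives \<open>u x powr p \<le> t k a b\<close>, while \<open>u x\<close> is comparable to \<open>t\<close>; hence \<open>t powr (p - 1) \<le> C b\<close>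
  (\<open>supersolution_touched_by_profile\<close>).

  Now let \<open>b\<close> tend to \<open>0\<close>. For \<open>p \<le> 1\<close> the height \<open>t\<close> stays below a multiple of \<open>u (axis l 1)\<close>, which
  is a contradiction. For \<open>p > 1\<close>, the comparison function at the fixed scale \<open>b = 1\<close> shows that \<open>u\<close> decays
  along the planes at most like the power \<open>- a\<close> of the distance, so \<open>t\<close> is at least a multiple of \<open>b powr (a / 2)\<close>; this
  contradicts \<open>t powr (p - 1) \<le> C b\<close> as soon as \<open>a (p - 1) < 2\<close>. An exponent \<open>a > k - 1\<close> with
  \<open>a (p - 1) < 2\<close> exists under the hypotheses on \<open>p\<close> (\<open>subcritical_decay_exponent\<close>).
\<close>

section \<open>Eigenvalue sums and orthonormal frames\<close>

text \<open>
  The form \<open>q x = m (x \<bullet> x) - x \<bullet> f x\<close>, with \<open>m\<close> the maximum of the Rayleigh quotient, is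
  nonnegative on \<open>T\<close> and vanishes at \<open>v\<close>. Perturbing \<open>v\<close> in the direction of the residual
  \<open>h = f v - m v\<close> gives \<open>q (v + t h) = t\<^sup>2 q h - 2 t (h \<bullet> h)\<close>, which would be negative for small
  positive \<open>t\<close> if \<open>h\<close> were not zero.
\<close>

lemma symmetric_rayleigh_maximizer_eigenvector:
  fixes f :: "'a::euclidean_space \<Rightarrow> 'a"
  assumes f: "linear f" and sym: "\<And>x y. f x \<bullet> y = x \<bullet> f y"
    and T: "subspace T" and inv: "f ` T \<subseteq> T"
    and v: "v \<in> T" "norm v = 1"
    and max: "\<And>x. x \<in> T \<Longrightarrow> norm x = 1 \<Longrightarrow> x \<bullet> f x \<le> v \<bullet> f v"
  shows "f v = (v \<bullet> f v) *\<^sub>R v"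
proof -
  define m where "m = v \<bullet> f v"
  define q where "q x = m * (x \<bullet> x) - x \<bullet> f x" for x
  define h where "h = f v - m *\<^sub>R v"
  have q_nonneg: "q x \<ge> 0" if "x \<in> T" for x
  proof (cases "x = 0")
    case True
    then show ?thesis by (simp add: q_def linear_0[OF f])
  next
    case False
    let ?y = "(1 / norm x) *\<^sub>R x"
    have "?y \<in> T" "norm ?y = 1"
      using that T False by (auto simp: subspace_scale)
    then have "?y \<bullet> f ?y \<le> m" using max m_def by blast
    moreover have "?y \<bullet> f ?y = (x \<bullet> f x) / (x \<bullet> x)"
      by (simp add: linear_scale[OF f] dot_square_norm power2_eq_square)
    ultimately have "(x \<bullet> f x) / (x \<bullet> x) \<le> m" by simp
    then show ?thesis
      using False by (simp add: q_def pos_divide_le_eq)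
  qed
  have hT: "h \<in> T"
    using v inv T by (auto simp: h_def intro!: subspace_diff subspace_scale)
  have vv: "v \<bullet> v = 1" using v by (simp add: norm_eq_1)
  have hv: "h \<bullet> v = 0"
    using vv by (simp add: h_def inner_diff_left m_def inner_commute[of "f v"])
  have hfv: "h \<bullet> f v = h \<bullet> h"
  proof -
    have "f v = h + m *\<^sub>R v" by (simp add: h_def)
    then have "h \<bullet> f v = h \<bullet> h + m * (h \<bullet> v)"
      by (metis inner_add_right inner_scaleR_right)
    then show ?thesis using hv by simp
  qed
  have expand: "q (v + t *\<^sub>R h) = t\<^sup>2 * q h - 2 * t * (h \<bullet> h)" for t
  proof -
    have "v \<bullet> f h = h \<bullet> h" using sym[of v h] hfv by (simp add: inner_commute)
    moreover have "v \<bullet> h = 0" using hv by (simp add: inner_commute)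
    ultimately show ?thesis
      unfolding q_def
      by (simp add: linear_add[OF f] linear_scale[OF f] inner_add_left inner_add_right
          hfv hv vv flip: m_def) (simp add: algebra_simps power2_eq_square)
  qed
  have "h = 0"
  proof (rule ccontr)
    assume "h \<noteq> 0"
    then have hh: "h \<bullet> h > 0" by simp
    have qh: "q h \<ge> 0" using q_nonneg hT by blast
    \<comment> \<open>Any \<open>t > 0\<close> with \<open>t q h < 2 (h \<bullet> h)\<close> would do; the \<open>+ 1\<close> covers \<open>q h = 0\<close>.\<close>
    define t where "t = (h \<bullet> h) / (q h + 1)"
    have t: "t > 0" using hh qh by (simp add: t_def)
    have "v + t *\<^sub>R h \<in> T" using v hT T by (simp add: subspace_add subspace_scale)
    then have "t\<^sup>2 * q h - 2 * t * (h \<bullet> h) \<ge> 0" using q_nonneg expand by metis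
    then have "t * (t * q h - 2 * (h \<bullet> h)) \<ge> 0" by (simp add: algebra_simps power2_eq_square)
    then have "t * q h \<ge> 2 * (h \<bullet> h)" using t by (simp add: zero_le_mult_iff)
    moreover have "t * q h \<le> t * (q h + 1)" using t by simp
    moreover have "t * (q h + 1) = h \<bullet> h" using qh by (simp add: t_def)
    ultimately show False using hh by linarith
  qed
  then show ?thesis by (simp add: h_def m_def)
qed

text \<open>
  The spectral theorem, by induction on the dimension: the orthogonal complement of an
  eigenvector within an invariant subspace is again invariant. Stating it for invariant
  subspaces instead of the whole space is what makes the induction possible.
\<close>

lemma symmetric_orthonormal_eigenbasis_subspace:
  fixes f :: "'a::euclidean_space \<Rightarrow> 'a"
  assumes f: "linear f" and sym: "\<And>x y. f x \<bullet> y = x \<bullet> f y"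
  shows "subspace T \<Longrightarrow> f ` T \<subseteq> T \<Longrightarrow>
    \<exists>B\<subseteq>T. finite B \<and> card B = dim T \<and> pairwise orthogonal B \<and>
      (\<forall>v\<in>B. norm v = 1 \<and> (\<exists>c. f v = c *\<^sub>R v))"
proof (induction "dim T" arbitrary: T)
  case 0
  then show ?case by (intro exI[of _ "{}"]) (auto simp: pairwise_def)
next
  case (Suc n)
  note T = Suc.prems(1) and inv = Suc.prems(2)
  let ?K = "sphere 0 1 \<inter> T"
  obtain x where x: "x \<in> T" "x \<noteq> 0"
    using Suc.hyps(2) by (metis Zero_not_Suc dim_eq_0 insertCI subsetI)
  have "(1 / norm x) *\<^sub>R x \<in> ?K" using x T by (simp add: subspace_scale)
  then have "?K \<noteq> {}" by blast
  moreover have "compact ?K" by (intro compact_Int_closed closed_subspace T) auto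
  moreover have "continuous_on ?K (\<lambda>x. x \<bullet> f x)"
    by (intro continuous_intros linear_continuous_on linear_conv_bounded_linear[THEN iffD1] f)
  ultimately obtain v where v: "v \<in> ?K" "\<And>x. x \<in> ?K \<Longrightarrow> x \<bullet> f x \<le> v \<bullet> f v"
    using continuous_attains_sup by meson
  have eig: "f v = (v \<bullet> f v) *\<^sub>R v"
    by (rule symmetric_rayleigh_maximizer_eigenvector[OF f sym T inv]) (use v in auto)
  define T' where "T' = {y \<in> T. \<forall>x\<in>span {v}. orthogonal x y}"
  have T'_alt: "T' = {y \<in> T. v \<bullet> y = 0}"
    by (auto simp: T'_def orthogonal_def span_singleton)
  have "span {v} \<subseteq> T" using T v by (intro span_minimal) auto
  then have "dim T' + dim (span {v}) = dim T"
    unfolding T'_def by (intro dim_subspace_orthogonal_to_vectors subspace_span T)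
  moreover have "dim (span {v}) = 1"
    using v by (auto simp: dim_singleton)
  ultimately have dT': "dim T' = n" using Suc.hyps(2) by simp
  have sT': "subspace T'"
    using T unfolding T'_alt subspace_def by (auto simp: inner_add_right)
  have iT': "f ` T' \<subseteq> T'"
  proof
    fix z assume "z \<in> f ` T'"
    then obtain y where y: "y \<in> T" "v \<bullet> y = 0" "z = f y" by (auto simp: T'_alt)
    have "v \<bullet> f y = f v \<bullet> y" by (simp add: sym)
    also have "\<dots> = 0" by (subst eig) (simp add: y)
    finally show "z \<in> T'" using y inv by (auto simp: T'_alt)
  qed
  obtain B where B: "B \<subseteq> T'" "finite B" "card B = dim T'" "pairwise orthogonal B"
      "\<forall>v\<in>B. norm v = 1 \<and> (\<exists>c. f v = c *\<^sub>R v)"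
    using Suc.hyps(1)[OF dT'[symmetric] sT' iT'] by blast
  have orth: "v \<bullet> y = 0" if "y \<in> B" for y using that B(1) by (auto simp: T'_alt)
  have vB: "v \<notin> B" using orth[of v] v by auto
  show ?case
  proof (intro exI[of _ "insert v B"] conjI)
    show "card (insert v B) = dim T" using B dT' Suc.hyps(2) vB by simp
    show "pairwise orthogonal (insert v B)"
      using B(4) orth by (auto simp: pairwise_insert orthogonal_def inner_commute)
    show "insert v B \<subseteq> T" using B(1) v by (auto simp: T'_alt)
  qed (use B v eig in auto)
qed

lemma symmetric_matrix_eigenbasis:
  fixes X :: "real ^ 'n ^ 'n"
  assumes "transpose X = X"
  obtains q :: "'n \<Rightarrow> real ^ 'n" and c :: "'n \<Rightarrow> real"
  where "\<And>i j. q i \<bullet> q j = (if i = j then 1 else 0)" "\<And>i. X *v q i = c i *\<^sub>R q i"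
proof -
  have sym: "(X *v x) \<bullet> y = x \<bullet> (X *v y)" for x y
    by (metis assms dot_lmul_matrix vector_transpose_matrix)
  obtain B where B: "finite B" "card B = dim (UNIV :: (real ^ 'n) set)" "pairwise orthogonal B"
      "\<forall>v\<in>B. norm v = 1 \<and> (\<exists>c. X *v v = c *\<^sub>R v)"
    using symmetric_orthonormal_eigenbasis_subspace[of "\<lambda>x. X *v x" UNIV] sym
    by (auto simp: matrix_vector_mul_linear)
  have "card (UNIV :: 'n set) = card B" using B by simp
  then obtain q where q: "bij_betw q (UNIV :: 'n set) B"
    using B(1) by (metis finite bij_betw_iff_card)
  have "q i \<bullet> q j = (if i = j then 1 else 0)" for i j
  proof -
    have m: "q i \<in> B" "q j \<in> B" using q by (auto simp: bij_betw_def)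
    have "q i = q j \<longleftrightarrow> i = j" using q by (auto simp: bij_betw_def inj_on_def)
    then show ?thesis using m B(3,4)
      by (auto simp: pairwise_def orthogonal_def norm_eq_1)
  qed
  moreover obtain c where "\<forall>i. X *v q i = c i *\<^sub>R q i"
  proof -
    have "\<forall>i. \<exists>c. X *v q i = c *\<^sub>R q i" using q B(4) by (auto simp: bij_betw_def)
    then show ?thesis using that by metis
  qed
  ultimately show ?thesis using that by blast
qed

lemma orthonormal_family_expansion:
  fixes q :: "'n \<Rightarrow> real ^ 'n"
  assumes q: "\<And>i j. q i \<bullet> q j = (if i = j then 1 else 0)"
  shows "(\<Sum>i\<in>UNIV. (v \<bullet> q i) *\<^sub>R q i) = v"
proof -
  define Q :: "real ^ 'n ^ 'n" where "Q = (\<chi> i j. q j $ i)"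
  have "transpose Q ** Q = mat 1"
    using q by (simp add: Q_def transpose_def matrix_matrix_mult_def mat_def vec_eq_iff inner_vec_def)
  then have "Q ** transpose Q = mat 1" by (simp add: matrix_left_right_inverse)
  then have "Q *v (transpose Q *v v) = v" by (metis matrix_vector_mul_assoc matrix_vector_mul_lid)
  then show ?thesis
    by (simp add: Q_def transpose_def matrix_vector_mult_def vec_eq_iff inner_vec_def sum_distrib_right
        mult_ac)
qed

text \<open>
  With the eigenvectors as the columns of \<open>Q\<close>, the eigenvalue equations say
  \<open>(z I - X) Q = Q D\<close> for a diagonal \<open>D\<close>. Determinants are taken over the polynomial ring, where
  \<open>det Q\<close> cancels because it is nonzero.
\<close>

lemma charpoly_eigenbasis:
  fixes X :: "real ^ 'n ^ 'n" and q :: "'n \<Rightarrow> real ^ 'n"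
  assumes q: "\<And>i j. q i \<bullet> q j = (if i = j then 1 else 0)"
    and c: "\<And>i. X *v q i = c i *\<^sub>R q i"
  shows "charpoly X = (\<Prod>i\<in>UNIV. [:- c i, 1:])"
proof -
  define Q :: "real poly ^ 'n ^ 'n" where "Q = (\<chi> i j. [:q j $ i:])"
  define M where "M = mat [:0, 1:] - (\<chi> i j. [:X $ i $ j:])"
  define D :: "real poly ^ 'n ^ 'n" where "D = (\<chi> i j. if i = j then [:- c i, 1:] else 0)"
  have const_sum: "(\<Sum>i\<in>UNIV. [:h i:]) = [:\<Sum>i\<in>UNIV. h i:]" for h :: "'n \<Rightarrow> real"
    by (induction rule: infinite_finite_induct) auto
  have "transpose Q ** Q = mat 1"
    using q by (auto simp: Q_def transpose_def matrix_matrix_mult_def mat_def vec_eq_iff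
        inner_vec_def const_sum pCons_one)
  then have "det (transpose Q ** Q) = 1" by (simp add: det_I)
  then have Q0: "det Q \<noteq> 0" by (auto simp: det_mul)
  have "M ** Q = Q ** D"
  proof -
    have "(\<Sum>k\<in>UNIV. X $ i $ k * q j $ k) = c j * q j $ i" for i j
      using c[of j] by (simp add: matrix_vector_mult_def vec_eq_iff)
    then have eig: "(\<Sum>k\<in>UNIV. [:X $ i $ k:] * [:q j $ k:]) = [:c j * q j $ i:]" for i j
      using const_sum[of "\<lambda>k. X $ i $ k * q j $ k"] by (simp add: mult.commute)
    have "(\<Sum>k\<in>UNIV. ((if i = k then [:0, 1:] else 0) - [:X $ i $ k:]) * [:q j $ k:])
        = [:0, 1:] * [:q j $ i:] - [:c j * q j $ i:]" for i j
      unfolding left_diff_distrib sum_subtractf eig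
      by (simp add: if_distrib[of "\<lambda>x. x * _"] if_distrib[of "\<lambda>x. smult _ x"] cong: if_cong)
    then have "(M ** Q) $ i $ j = (Q ** D) $ i $ j" for i j
      by (simp add: M_def Q_def D_def matrix_matrix_mult_def mat_def
          if_distrib[of "\<lambda>x. _ * x"] if_distrib[of "\<lambda>x. smult _ x"] cong: if_cong)
    then show ?thesis by (simp add: vec_eq_iff)
  qed
  then have "det M * det Q = det Q * det D" by (metis det_mul)
  then have "det M = det D" using Q0 by simp
  moreover have "det D = (\<Prod>i\<in>UNIV. D $ i $ i)"
    by (rule det_diagonal) (simp add: D_def)
  ultimately show ?thesis by (simp add: charpoly_def M_def D_def)
qed

text \<open>
  Among all weights in \<open>[0, 1]\<close> of total mass \<open>k\<close>, the weighted sum of the entries is largest when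
  the mass sits on the \<open>k\<close> largest ones. Subtracting the threshold \<open>t\<close>, the smallest of the top
  \<open>k\<close> entries, makes this visible: only the positive parts of \<open>c i - t\<close> can contribute, and
  these live on the top \<open>k\<close> positions.
\<close>

lemma sum_top_sorted_ge:
  fixes c w :: "'n::finite \<Rightarrow> real"
  assumes w: "\<And>i. 0 \<le> w i" "\<And>i. w i \<le> 1" "(\<Sum>i\<in>UNIV. w i) = real k"
    and k: "0 < k" "k \<le> CARD('n)"
    and xs: "xs = sorted_list_of_multiset (image_mset c (mset_set UNIV))"
  shows "(\<Sum>i\<in>UNIV. c i * w i) \<le> (\<Sum>i = CARD('n) - k + 1..CARD('n). xs ! (i - 1))"
proof -
  let ?N = "CARD('n)"
  have len: "length xs = ?N" unfolding xs by (metis size_mset mset_sorted_list_of_multiset size_image_mset size_mset_set)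
  have sorted: "sorted xs" unfolding xs by simp
  define t where "t = xs ! (?N - k)"
  have "(\<Sum>i\<in>UNIV. c i * w i) - k * t = (\<Sum>i\<in>UNIV. (c i - t) * w i)"
    by (simp add: left_diff_distrib sum_subtractf w(3)[symmetric] sum_distrib_left mult.commute[of _ t])
  also have "\<dots> \<le> (\<Sum>i\<in>UNIV. max (c i - t) 0)"
  proof (rule sum_mono)
    fix i
    show "(c i - t) * w i \<le> max (c i - t) 0"
      using w(1,2)[of i] mult_left_le[of "w i" "c i - t"]
      by (cases "c i \<ge> t") (auto simp: mult_nonpos_nonneg)
  qed
  also have "\<dots> = (\<Sum>x\<in>#mset xs. max (x - t) 0)"
    by (simp add: xs sum_unfold_sum_mset image_mset.compositionality o_def)
  also have "\<dots> = (\<Sum>j<?N. max (xs ! j - t) 0)"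
    by (metis (no_types, lifting) len mset_map sum_mset_sum_list sum_list_sum_nth length_map nth_map sum.cong atLeast0LessThan lessThan_iff)
  also have "\<dots> = (\<Sum>j\<in>{?N-k..<?N}. max (xs ! j - t) 0)"
  proof (rule sum.mono_neutral_right)
    show "\<forall>j\<in>{..<?N} - {?N - k..<?N}. max (xs ! j - t) 0 = 0"
    proof
      fix j assume "j \<in> {..<?N} - {?N - k..<?N}"
      then have "xs ! j \<le> t"
        unfolding t_def using k len by (intro sorted_nth_mono[OF sorted]) auto
      then show "max (xs ! j - t) 0 = 0" by simp
    qed
  qed auto
  also have "\<dots> = (\<Sum>j\<in>{?N-k..<?N}. xs ! j - t)"
  proof (rule sum.cong[OF refl])
    fix j assume "j \<in> {?N-k..<?N}"
    then have "t \<le> xs ! j"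
      unfolding t_def using len by (intro sorted_nth_mono[OF sorted]) auto
    then show "max (xs ! j - t) 0 = xs ! j - t" by simp
  qed
  also have "\<dots> = (\<Sum>j\<in>{?N-k..<?N}. xs ! j) - k * t"
    using k by (simp add: sum_subtractf)
  also have "(\<Sum>j\<in>{?N-k..<?N}. xs ! j) = (\<Sum>i = ?N - k + 1..?N. xs ! (i - 1))"
    using k by (intro sum.reindex_bij_witness[of _ "\<lambda>i. i - 1" Suc]) auto
  finally show ?thesis by simp
qed

text \<open>
  The gap between the two sides is the squared distance of \<open>x\<close> from its projection to the span
  of \<open>B\<close>.
\<close>

lemma bessel_inequality:
  fixes B :: "'a::real_inner set"
  assumes "finite B" "pairwise orthogonal B" "\<And>v. v \<in> B \<Longrightarrow> norm v = 1"
  shows "(\<Sum>v\<in>B. (v \<bullet> x)\<^sup>2) \<le> x \<bullet> x"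
proof -
  let ?y = "\<Sum>v\<in>B. (v \<bullet> x) *\<^sub>R v"
  have 1: "x \<bullet> ?y = (\<Sum>v\<in>B. (v \<bullet> x)\<^sup>2)"
    by (simp add: inner_sum_right power2_eq_square inner_commute)
  have "w \<bullet> ?y = w \<bullet> x" if "w \<in> B" for w
  proof -
    have "w \<bullet> ?y = (\<Sum>v\<in>B. if v = w then w \<bullet> x else 0)"
      unfolding inner_sum_right using assms that
      by (intro sum.cong) (auto simp: pairwise_def orthogonal_def norm_eq_1)
    then show ?thesis using that assms(1) by simp
  qed
  then have 2: "?y \<bullet> ?y = (\<Sum>v\<in>B. (v \<bullet> x)\<^sup>2)"
    by (subst inner_sum_left) (simp add: power2_eq_square)
  have "0 \<le> (x - ?y) \<bullet> (x - ?y)" by simp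
  also have "\<dots> = x \<bullet> x - 2 * (x \<bullet> ?y) + ?y \<bullet> ?y"
    by (simp add: inner_diff_left inner_diff_right inner_commute)
  finally show ?thesis using 1 2 by linarith
qed

text \<open>
  Ky Fan's inequality. In an orthonormal eigenbasis \<open>q\<close>, the trace of \<open>X\<close> on the frame \<open>B\<close> is a
  weighted sum of eigenvalues. The weight of \<open>q i\<close> is the squared length of its projection to
  the span of \<open>B\<close>, hence at most \<open>1\<close> by Bessel, and the weights add up to \<open>k\<close> by Parseval. In the
  nonexistence proof the inequality is read backwards: a negative value of \<open>P_plus\<close> forces a negative trace on every orthonormal \<open>k\<close>-frame.
\<close>

lemma ky_fan_P_plus:
  fixes X :: "real ^ 'n ^ 'n"
  assumes X: "transpose X = X" and k: "0 < k" "k \<le> CARD('n)"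
    and B: "finite B" "card B = k" "pairwise orthogonal B" "\<And>v. v \<in> B \<Longrightarrow> norm v = 1"
  shows "(\<Sum>v\<in>B. v \<bullet> (X *v v)) \<le> P_plus k X"
proof -
  obtain q :: "'n \<Rightarrow> real ^ 'n" and c
    where q: "\<And>i j. q i \<bullet> q j = (if i = j then 1 else 0)"
      and c: "\<And>i. X *v q i = c i *\<^sub>R q i"
    using symmetric_matrix_eigenbasis[OF X] by blast
  define w where "w i = (\<Sum>v\<in>B. (v \<bullet> q i)\<^sup>2)" for i
  have parseval: "(\<Sum>i\<in>UNIV. (v \<bullet> q i)\<^sup>2) = v \<bullet> v" for v
  proof -
    have "v \<bullet> v = v \<bullet> (\<Sum>i\<in>UNIV. (v \<bullet> q i) *\<^sub>R q i)"
      by (simp add: orthonormal_family_expansion[OF q])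
    then show ?thesis by (simp add: inner_sum_right power2_eq_square)
  qed
  have quad: "v \<bullet> (X *v v) = (\<Sum>i\<in>UNIV. c i * (v \<bullet> q i)\<^sup>2)" for v
  proof -
    have "X *v v = X *v (\<Sum>i\<in>UNIV. (v \<bullet> q i) *\<^sub>R q i)"
      by (simp add: orthonormal_family_expansion[OF q])
    also have "\<dots> = (\<Sum>i\<in>UNIV. (v \<bullet> q i) *\<^sub>R (c i *\<^sub>R q i))"
      by (simp add: linear_sum[OF matrix_vector_mul_linear] linear_scale[OF matrix_vector_mul_linear] c)
    finally show ?thesis by (simp add: inner_sum_right power2_eq_square mult_ac)
  qed
  have "image_mset c (mset_set UNIV) = proots (charpoly X)"
    unfolding charpoly_eigenbasis[OF q c]
    by (subst proots_prod) (auto simp: sum_unfold_sum_mset)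
  then have ev: "eigenvalues X = sorted_list_of_multiset (image_mset c (mset_set UNIV))"
    by (simp add: eigenvalues_def)
  have "(\<Sum>v\<in>B. v \<bullet> (X *v v)) = (\<Sum>i\<in>UNIV. c i * w i)"
    unfolding quad w_def by (simp add: sum_distrib_left) (rule sum.swap)
  also have "\<dots> \<le> P_plus k X"
    unfolding P_plus_def eigval_def
  proof (rule sum_top_sorted_ge[OF _ _ _ k ev])
    show "0 \<le> w i" for i by (simp add: w_def sum_nonneg)
    show "w i \<le> 1" for i using bessel_inequality[OF B(1,3,4), of "q i"] q by (simp add: w_def)
    have "(\<Sum>i\<in>UNIV. w i) = (\<Sum>v\<in>B. v \<bullet> v)"
      unfolding w_def by (subst sum.swap) (simp add: parseval)
    also have "\<dots> = k" using B by (simp add: norm_eq_1)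
    finally show "(\<Sum>i\<in>UNIV. w i) = real k" .
  qed
  finally show ?thesis .
qed

section \<open>Functions of a weighted square distance\<close>

definition weighted_sq_dist :: "('n \<Rightarrow> real) \<Rightarrow> real ^ 'n \<Rightarrow> real ^ 'n \<Rightarrow> real" where
  "weighted_sq_dist d e x = (\<Sum>i\<in>UNIV. d i * (x $ i - e $ i)\<^sup>2)"

lemma weighted_sq_dist_nonneg: "(\<And>i. 0 \<le> d i) \<Longrightarrow> 0 \<le> weighted_sq_dist d e x"
  by (simp add: weighted_sq_dist_def sum_nonneg)

lemma continuous_on_weighted_sq_dist [continuous_intros]:
  "continuous_on S (weighted_sq_dist d e)"
  unfolding weighted_sq_dist_def by (intro continuous_intros)

lemma weighted_sq_dist_has_derivative:
  "(weighted_sq_dist d e has_derivative (\<lambda>h. \<Sum>i\<in>UNIV. 2 * d i * (x $ i - e $ i) * h $ i)) (at x)"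
proof -
  have "((\<lambda>x. \<Sum>i\<in>UNIV. d i * (x $ i - e $ i)\<^sup>2) has_derivative
      (\<lambda>h. \<Sum>i\<in>UNIV. 2 * d i * (x $ i - e $ i) * h $ i)) (at x)"
    by (auto intro!: derivative_eq_intros bounded_linear_imp_has_derivative bounded_linear_vec_nth
        simp: mult_ac)
  then show ?thesis by (simp add: weighted_sq_dist_def[abs_def])
qed

lemma has_derivative_vecI:
  fixes f :: "real ^ 'n \<Rightarrow> real ^ 'm"
  assumes "\<And>i. ((\<lambda>x. f x $ i) has_derivative (\<lambda>h. f' h $ i)) (at x)"
  shows "(f has_derivative f') (at x)"
  unfolding has_derivative_componentwise_within[of f f' x UNIV]
proof
  fix b :: "real ^ 'm" assume "b \<in> Basis"
  then obtain i where "b = axis i 1" by (auto simp: Basis_vec_def)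
  then show "((\<lambda>x. f x \<bullet> b) has_derivative (\<lambda>x. f' x \<bullet> b)) (at x)"
    using assms[of i] by (simp add: inner_axis)
qed

lemma has_derivative_weighted_profile:
  assumes "\<And>i. 0 \<le> d i" "\<And>s. 0 \<le> s \<Longrightarrow> (G has_real_derivative G' s) (at s)"
  shows "((\<lambda>x. G (weighted_sq_dist d e x)) has_derivative
    (\<lambda>h. G' (weighted_sq_dist d e x) * (\<Sum>i\<in>UNIV. 2 * d i * (x $ i - e $ i) * h $ i))) (at x)"
proof -
  have "0 \<le> weighted_sq_dist d e x" using assms(1) by (rule weighted_sq_dist_nonneg)
  from has_derivative_compose[OF weighted_sq_dist_has_derivative
      assms(2)[OF this, THEN has_field_derivative_imp_has_derivative]]
  show ?thesis by simp
qed

lemma sum_mult_axis: "(\<Sum>i\<in>UNIV. a i * axis j (1::real) $ i) = a j"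
  by (simp add: axis_def if_distrib[of "\<lambda>x. _ * x"] cong: if_cong)

lemma grad_weighted_profile:
  assumes "\<And>i. 0 \<le> d i" "\<And>s. 0 \<le> s \<Longrightarrow> (G has_real_derivative G' s) (at s)"
  shows "grad (\<lambda>x. G (weighted_sq_dist d e x)) =
    (\<lambda>x. \<chi> i. G' (weighted_sq_dist d e x) * (2 * d i * (x $ i - e $ i)))"
proof
  fix x
  have D: "frechet_derivative (\<lambda>x. G (weighted_sq_dist d e x)) (at x) =
      (\<lambda>h. G' (weighted_sq_dist d e x) * (\<Sum>i\<in>UNIV. 2 * d i * (x $ i - e $ i) * h $ i))"
    by (rule frechet_derivative_at[OF has_derivative_weighted_profile, symmetric]) (use assms in auto)
  show "grad (\<lambda>x. G (weighted_sq_dist d e x)) x =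
      (\<chi> i. G' (weighted_sq_dist d e x) * (2 * d i * (x $ i - e $ i)))"
    unfolding grad_def D by (simp add: sum_mult_axis)
qed

lemma has_derivative_grad_weighted_profile:
  fixes e :: "real ^ 'n"
  assumes "\<And>i. 0 \<le> d i" "\<And>s. 0 \<le> s \<Longrightarrow> (G has_real_derivative G' s) (at s)"
    "\<And>s. 0 \<le> s \<Longrightarrow> (G' has_real_derivative G'' s) (at s)"
  defines "s \<equiv> weighted_sq_dist d e"
  shows "(grad (\<lambda>x. G (weighted_sq_dist d e x)) has_derivative
    (\<lambda>h. \<chi> i. G' (s x) * (2 * d i * h $ i) +
       G'' (s x) * (\<Sum>j\<in>UNIV. 2 * d j * (x $ j - e $ j) * h $ j) * (2 * d i * (x $ i - e $ i)))) (at x)"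
proof -
  have grad: "grad (\<lambda>x. G (weighted_sq_dist d e x)) =
    (\<lambda>x. \<chi> i. G' (weighted_sq_dist d e x) * (2 * d i * (x $ i - e $ i)))"
    by (rule grad_weighted_profile) (use assms in auto)
  have "((\<lambda>x. G' (weighted_sq_dist d e x) * (2 * d i * (x $ i - e $ i))) has_derivative
    (\<lambda>h. G' (s x) * (2 * d i * h $ i) +
       G'' (s x) * (\<Sum>j\<in>UNIV. 2 * d j * (x $ j - e $ j) * h $ j) * (2 * d i * (x $ i - e $ i)))) (at x)" for i
  proof -
    have 1: "((\<lambda>x. 2 * d i * (x $ i - e $ i)) has_derivative (\<lambda>h. 2 * d i * h $ i)) (at x)"
      by (auto intro!: derivative_eq_intros bounded_linear_imp_has_derivative bounded_linear_vec_nth)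
    have 2: "((\<lambda>x. G' (weighted_sq_dist d e x)) has_derivative
      (\<lambda>h. G'' (s x) * (\<Sum>j\<in>UNIV. 2 * d j * (x $ j - e $ j) * h $ j))) (at x)"
      unfolding s_def by (rule has_derivative_weighted_profile) (use assms in auto)
    show ?thesis using has_derivative_mult[OF 2 1] by (simp add: s_def)
  qed
  then show ?thesis
    unfolding grad by (intro has_derivative_vecI) simp
qed

text \<open>
  The rank-one part points along the gradient of the weighted square distance; the rest is
  diagonal. Restricting \<open>G\<close> to nonnegative arguments suffices because the distance is
  nonnegative, and lets \<open>G\<close> be a power of \<open>1 + s\<close>.
\<close>

lemma hessian_weighted_profile:
  fixes e :: "real ^ 'n"
  assumes "\<And>i. 0 \<le> d i" "\<And>s. 0 \<le> s \<Longrightarrow> (G has_real_derivative G' s) (at s)"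
    "\<And>s. 0 \<le> s \<Longrightarrow> (G' has_real_derivative G'' s) (at s)"
  defines "s \<equiv> weighted_sq_dist d e"
  shows "hessian (\<lambda>x. G (weighted_sq_dist d e x)) =
    (\<lambda>x. \<chi> i j. 4 * G'' (s x) * (d i * (x $ i - e $ i)) * (d j * (x $ j - e $ j)) +
      (if i = j then 2 * d i * G' (s x) else 0))"
proof
  fix x
  have D: "frechet_derivative (grad (\<lambda>x. G (weighted_sq_dist d e x))) (at x) =
    (\<lambda>h. \<chi> i. G' (s x) * (2 * d i * h $ i) +
       G'' (s x) * (\<Sum>j\<in>UNIV. 2 * d j * (x $ j - e $ j) * h $ j) * (2 * d i * (x $ i - e $ i)))"
    unfolding s_def
    by (rule frechet_derivative_at[OF has_derivative_grad_weighted_profile, symmetric])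
      (use assms in auto)
  show "hessian (\<lambda>x. G (weighted_sq_dist d e x)) x =
    (\<chi> i j. 4 * G'' (s x) * (d i * (x $ i - e $ i)) * (d j * (x $ j - e $ j)) +
      (if i = j then 2 * d i * G' (s x) else 0))"
    unfolding hessian_def jacobian_def D matrix_def sum_mult_axis
    by (auto simp: vec_eq_iff axis_def)
qed

lemma C2_on_weighted_profile:
  fixes e :: "real ^ 'n"
  assumes d: "\<And>i. 0 \<le> d i" and G: "\<And>s. 0 \<le> s \<Longrightarrow> (G has_real_derivative G' s) (at s)"
    and G': "\<And>s. 0 \<le> s \<Longrightarrow> (G' has_real_derivative G'' s) (at s)"
    and G'': "continuous_on {0..} G''"
  shows "C2_on S (\<lambda>x. G (weighted_sq_dist d e x))"
  unfolding C2_on_def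
proof (intro conjI ballI)
  show "(\<lambda>x. G (weighted_sq_dist d e x)) differentiable at x" for x
    using has_derivative_weighted_profile[of d G G', OF d G] by (rule differentiableI)
  show "grad (\<lambda>x. G (weighted_sq_dist d e x)) differentiable at x" for x
    using has_derivative_grad_weighted_profile[of d G G' G'', OF d G G'] by (rule differentiableI)
  have "continuous_on {0..} G'"
    using G' by (meson DERIV_continuous_on atLeast_iff has_field_derivative_at_within)
  then have "continuous_on S (\<lambda>x. G' (weighted_sq_dist d e x))"
    by (rule continuous_on_compose2) (auto intro: continuous_intros weighted_sq_dist_nonneg d)
  moreover have "continuous_on S (\<lambda>x. G'' (weighted_sq_dist d e x))"
    using G'' by (rule continuous_on_compose2) (auto intro: continuous_intros weighted_sq_dist_nonneg d)
  ultimately have "continuous_on S (\<lambda>x. 4 * G'' (weighted_sq_dist d e x) * (d i * (x $ i - e $ i)) *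
      (d j * (x $ j - e $ j)) + (if i = j then 2 * d i * G' (weighted_sq_dist d e x) else 0))" for i j
    by (cases "i = j") (auto intro!: continuous_intros)
  moreover have "hessian (\<lambda>x. G (weighted_sq_dist d e x)) =
    (\<lambda>x. \<chi> i j. 4 * G'' (weighted_sq_dist d e x) * (d i * (x $ i - e $ i)) * (d j * (x $ j - e $ j)) +
      (if i = j then 2 * d i * G' (weighted_sq_dist d e x) else 0))"
    by (rule hessian_weighted_profile) (use d G G' in auto)
  ultimately show "continuous_on S (hessian (\<lambda>x. G (weighted_sq_dist d e x)))"
    by (auto intro!: continuous_on_vec_lambda)
qed

section \<open>Extrema against lower semicontinuous functions\<close>

text \<open>
  A quotient of this kind is upper semicontinuous. If it had no maximum, every point would have
  a neighbourhood on which the quotient stays below one of its values; finitely many of these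
  neighbourhoods cover \<open>K\<close>, and the largest of the corresponding values would exceed itself.
  The numerator may vanish, so that \<open>K\<close> can be a closed superlevel set of the test function.
\<close>

lemma continuous_over_lower_semicontinuous_attains_max:
  fixes u f :: "'a::metric_space \<Rightarrow> real"
  assumes K: "compact K" "K \<noteq> {}" "K \<subseteq> S"
    and u: "lower_semicontinuous_on S u" "\<And>x. x \<in> S \<Longrightarrow> 0 < u x"
    and f: "continuous_on K f" "\<And>x. x \<in> K \<Longrightarrow> 0 \<le> f x"
  shows "\<exists>x\<in>K. \<forall>y\<in>K. f y / u y \<le> f x / u x"
proof (rule ccontr)
  assume "\<not> ?thesis"
  then have "\<forall>x\<in>K. \<exists>y\<in>K. f x / u x < f y / u y" by (auto simp: not_le)
  then obtain Y where Y: "\<And>x. x \<in> K \<Longrightarrow> Y x \<in> K" "\<And>x. x \<in> K \<Longrightarrow> f x / u x < f (Y x) / u (Y x)"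
    by metis
  have "\<exists>W. open W \<and> x \<in> W \<and> (\<forall>z\<in>W \<inter> K. f z / u z < f (Y x) / u (Y x))" if x: "x \<in> K" for x
  proof -
    define c where "c = f (Y x) / u (Y x)"
    have ux: "0 < u x" using x K u by blast
    have "0 \<le> f x / u x" using ux f x by simp
    then have "0 < c" using Y(2)[OF x] by (simp add: c_def)
    moreover have "f x < c * u x" using Y(2)[OF x] ux by (simp add: c_def[symmetric] pos_divide_less_eq)
    ultimately have c: "0 < c" "f x < c * u x" by auto
    define m where "m = (f x + c * u x) / 2"
    have m: "f x < m" "m < c * u x" using c by (auto simp: m_def)
    have "m / c < u x" using m c by (simp add: pos_divide_less_eq mult.commute)
    then have "\<forall>\<^sub>F z in at x within S. m / c < u z"
      using u(1) x K(3) by (auto simp: lower_semicontinuous_on_def)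
    then have "\<forall>\<^sub>F z in at x within K. m / c < u z"
      using K(3) by (metis at_le filter_leD)
    moreover have "\<forall>\<^sub>F z in at x within K. f z < m"
      using f(1) x m by (auto simp: continuous_on_def intro: order_tendstoD)
    ultimately have "\<forall>\<^sub>F z in at x within K. m / c < u z \<and> f z < m"
      by (rule eventually_conj)
    then obtain W where W: "open W" "x \<in> W" "\<And>z. z \<in> W \<Longrightarrow> z \<noteq> x \<Longrightarrow> z \<in> K \<Longrightarrow> m / c < u z \<and> f z < m"
      by (auto simp: eventually_at_topological)
    have "f z / u z < c" if "z \<in> W \<inter> K" for z
    proof -
      have "m / c < u z \<and> f z < m" using that W m \<open>m / c < u x\<close> by (cases "z = x") auto
      then have "f z < c * u z" using c by (simp add: pos_divide_less_eq mult.commute)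
      then show ?thesis using that K u(2) by (auto simp: pos_divide_less_eq)
    qed
    then show ?thesis using W unfolding c_def by blast
  qed
  then obtain W where W: "\<And>x. x \<in> K \<Longrightarrow> open (W x)" "\<And>x. x \<in> K \<Longrightarrow> x \<in> W x"
    "\<And>x z. x \<in> K \<Longrightarrow> z \<in> W x \<inter> K \<Longrightarrow> f z / u z < f (Y x) / u (Y x)"
    by metis
  obtain C where C: "C \<subseteq> K" "finite C" "K \<subseteq> (\<Union>x\<in>C. W x)"
    using compactE_image[OF K(1), of K W] W by (metis UN_I subsetI)
  then have "C \<noteq> {}" using K(2) by auto
  define M where "M = Max ((\<lambda>x. f (Y x) / u (Y x)) ` C)"
  have "M \<in> (\<lambda>x. f (Y x) / u (Y x)) ` C"
    unfolding M_def using C(2) \<open>C \<noteq> {}\<close> by (intro Max_in) auto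
  then obtain x where x: "x \<in> C" "M = f (Y x) / u (Y x)" by blast
  have "Y x \<in> K" using x C Y by blast
  then obtain y where y: "y \<in> C" "Y x \<in> W y" using C by blast
  then have "M < f (Y y) / u (Y y)" using x W(3)[of y "Y x"] C \<open>Y x \<in> K\<close> by auto
  moreover have "f (Y y) / u (Y y) \<le> M" using y C by (simp add: M_def)
  ultimately show False by simp
qed

section \<open>Touching a supersolution from below\<close>

text \<open>
  The Hessians of the test functions have this shape, with \<open>A\<close> and \<open>m\<close> multiples of the second
  and first derivative of the profile.
\<close>

lemma rank_one_plus_diagonal_quadratic_form:
  fixes d w :: "'n::finite \<Rightarrow> real" and v :: "real ^ 'n"
  shows "v \<bullet> ((\<chi> i j. A * (d i * w i) * (d j * w j) + (if i = j then d i * m else 0)) *v v) =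
    A * (\<Sum>i\<in>UNIV. d i * w i * v $ i)\<^sup>2 + m * (\<Sum>i\<in>UNIV. d i * (v $ i)\<^sup>2)"
proof -
  have "(A * (d i * w i) * (d j * w j) + (if i = j then d i * m else 0)) * v $ j =
      A * (d i * w i) * (d j * w j * v $ j) + (if i = j then d i * m * v $ i else 0)" for i j
    by (simp add: algebra_simps)
  then have "(\<Sum>j\<in>UNIV. (A * (d i * w i) * (d j * w j) + (if i = j then d i * m else 0)) * v $ j) =
      A * (d i * w i) * (\<Sum>j\<in>UNIV. d j * w j * v $ j) + d i * m * v $ i" for i
    by (simp add: sum.distrib sum_distrib_left)
  then show ?thesis
    by (simp add: matrix_vector_mult_def inner_vec_def distrib_left sum.distrib power2_eq_square
        sum_distrib_left sum_distrib_right mult_ac)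
qed

lemma orthonormal_axes:
  fixes J :: "'n::finite set"
  shows "card ((\<lambda>i. axis i (1::real)) ` J) = card J"
  "pairwise orthogonal ((\<lambda>i. axis i (1::real)) ` J)"
proof -
  have "inj_on (\<lambda>i. axis i (1::real)) J" by (auto simp: inj_on_def axis_eq_axis)
  then show "card ((\<lambda>i. axis i (1::real)) ` J) = card J" by (rule card_image)
  show "pairwise orthogonal ((\<lambda>i. axis i (1::real)) ` J)"
    by (auto simp: pairwise_def orthogonal_def inner_axis_axis)
qed

text \<open>
  The weights \<open>d\<close> take the value \<open>b\<close> in the \<open>k\<close> directions of \<open>J\<close>, called tangential below, and
  \<open>c\<close> in the others. In the application \<open>A\<close> is positive and \<open>m\<close> negative, and the bounds say where
  the rank-one part wins.
\<close>

context
  fixes J :: "'n::finite set" and b c A m :: real and w :: "real ^ 'n" and k :: nat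
    and d :: "'n \<Rightarrow> real" and X :: "real ^ 'n ^ 'n"
  assumes J: "card J = k" "0 < k" and A: "0 \<le> A" and b: "0 \<le> b"
  defines "d \<equiv> \<lambda>i. if i \<in> J then b else c"
  defines "X \<equiv> (\<chi> i j. A * (d i * w $ i) * (d j * w $ j) + (if i = j then d i * m else 0))"
begin

lemma anisotropic_symmetric: "transpose X = X"
  by (auto simp: X_def transpose_def vec_eq_iff mult_ac)

lemma anisotropic_card_le: "k \<le> CARD('n)"
  unfolding J(1)[symmetric] by (rule card_mono) auto

lemma anisotropic_quadratic_form:
  "v \<bullet> (X *v v) = A * (\<Sum>i\<in>UNIV. d i * w $ i * v $ i)\<^sup>2 + m * (\<Sum>i\<in>UNIV. d i * (v $ i)\<^sup>2)"
  unfolding X_def by (rule rank_one_plus_diagonal_quadratic_form)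

lemma anisotropic_quadratic_form_axis:
  "axis i 1 \<bullet> (X *v axis i 1) = A * (d i * w $ i)\<^sup>2 + m * d i"
  unfolding anisotropic_quadratic_form
  by (simp add: axis_def if_distrib[of "\<lambda>x. _ * x"] if_distrib[of "\<lambda>x. x ^ 2"] cong: if_cong)

lemma P_plus_ge_tangential_frame:
  "b * (A * (b * (\<Sum>i\<in>J. (w $ i)\<^sup>2)) + k * m) \<le> P_plus k X"
proof -
  let ?B = "(\<lambda>i. axis i (1::real)) ` J"
  have "(\<Sum>v\<in>?B. v \<bullet> (X *v v)) = (\<Sum>i\<in>J. A * (b * w $ i)\<^sup>2 + m * b)"
    by (subst sum.reindex) (auto simp: inj_on_def axis_eq_axis anisotropic_quadratic_form_axis d_def
        intro!: sum.cong)
  also have "\<dots> = b * (A * (b * (\<Sum>i\<in>J. (w $ i)\<^sup>2)) + k * m)"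
    using J by (simp add: sum.distrib power_mult_distrib sum_distrib_left distrib_left mult_ac power2_eq_square)
  finally have "(\<Sum>v\<in>?B. v \<bullet> (X *v v)) = b * (A * (b * (\<Sum>i\<in>J. (w $ i)\<^sup>2)) + k * m)" .
  moreover have "(\<Sum>v\<in>?B. v \<bullet> (X *v v)) \<le> P_plus k X"
  proof (rule ky_fan_P_plus[OF anisotropic_symmetric J(2) anisotropic_card_le])
    show "card ?B = k" using orthonormal_axes(1)[of J] J(1) by simp
    show "pairwise orthogonal ?B" by (rule orthonormal_axes(2))
  qed (auto simp: norm_eq_1 inner_axis_axis)
  ultimately show ?thesis by simp
qed

text \<open>
  The frame consists of the unit vector along the part of \<open>w\<close> outside \<open>J\<close> and of \<open>k - 1\<close> of the
  axes in \<open>J\<close>. On these axes the rank-one part contributes nonnegatively and is dropped.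
\<close>

lemma P_plus_ge_mixed_frame:
  assumes z: "0 < (\<Sum>i\<in>-J. (w $ i)\<^sup>2)"
  shows "c * (A * (c * (\<Sum>i\<in>-J. (w $ i)\<^sup>2)) + m) + (real k - 1) * b * m \<le> P_plus k X"
proof -
  define r where "r = sqrt (\<Sum>i\<in>-J. (w $ i)\<^sup>2)"
  have r: "0 < r" "r\<^sup>2 = (\<Sum>i\<in>-J. (w $ i)\<^sup>2)" using z by (auto simp: r_def)
  define v :: "real ^ 'n" where "v = (\<chi> i. if i \<in> J then 0 else w $ i / r)"
  have sum_v: "(\<Sum>i\<in>UNIV. f i (v $ i)) = (\<Sum>i\<in>-J. f i (w $ i / r))" if "\<And>i. f i 0 = 0" for f :: "'n \<Rightarrow> real \<Rightarrow> real"
    by (rule sum.mono_neutral_cong_right) (auto simp: v_def that)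
  have "v \<bullet> v = 1"
    using sum_v[of "\<lambda>i x. x\<^sup>2"] r(1)
    by (simp add: inner_vec_def power_divide flip: sum_divide_distrib power2_eq_square r(2))
  then have nv: "norm v = 1" by (simp add: norm_eq_1)
  obtain i0 where i0: "i0 \<in> J" using J by fastforce
  define J' where "J' = J - {i0}"
  have J': "J' \<subseteq> J" "real (card J') = real k - 1" using i0 J by (auto simp: J'_def of_nat_diff)
  let ?B' = "(\<lambda>i. axis i (1::real)) ` J'"
  have ov: "v \<bullet> y = 0" if "y \<in> ?B'" for y
    using that J' by (auto simp: inner_axis v_def)
  then have vB: "v \<notin> ?B'" using nv by (metis norm_eq_1 zero_neq_one)
  have qv: "v \<bullet> (X *v v) = c * (A * (c * (\<Sum>i\<in>-J. (w $ i)\<^sup>2)) + m)"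
  proof -
    have "(\<Sum>i\<in>UNIV. d i * w $ i * v $ i) = (\<Sum>i\<in>-J. d i * w $ i * (w $ i / r))"
      by (rule sum_v) simp
    also have "\<dots> = (\<Sum>i\<in>-J. c * (w $ i)\<^sup>2 / r)"
      by (rule sum.cong) (auto simp: d_def power2_eq_square)
    also have "\<dots> = c * r\<^sup>2 / r"
      by (simp add: r(2) flip: sum_divide_distrib sum_distrib_left)
    also have "\<dots> = c * r" using r(1) by (simp add: power2_eq_square)
    finally have 1: "(\<Sum>i\<in>UNIV. d i * w $ i * v $ i) = c * r" .
    have "(\<Sum>i\<in>UNIV. d i * (v $ i)\<^sup>2) = (\<Sum>i\<in>-J. d i * (w $ i / r)\<^sup>2)"
      by (rule sum_v) simp
    also have "\<dots> = (\<Sum>i\<in>-J. c * (w $ i)\<^sup>2 / r\<^sup>2)"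
      by (rule sum.cong) (auto simp: d_def power_divide)
    also have "\<dots> = c * r\<^sup>2 / r\<^sup>2"
      by (simp add: r(2) flip: sum_divide_distrib sum_distrib_left)
    also have "\<dots> = c" using r(1) by simp
    finally have 2: "(\<Sum>i\<in>UNIV. d i * (v $ i)\<^sup>2) = c" .
    show ?thesis unfolding anisotropic_quadratic_form 1 2
      by (simp add: power_mult_distrib r(2) power2_eq_square[of c] algebra_simps)
  qed
  have "(real k - 1) * b * m = (\<Sum>i\<in>J'. m * b)" using J' by simp
  also have "\<dots> \<le> (\<Sum>i\<in>J'. axis i 1 \<bullet> (X *v axis i 1))"
    unfolding anisotropic_quadratic_form_axis using A J' by (intro sum_mono) (auto simp: d_def)
  also have "\<dots> = (\<Sum>v\<in>?B'. v \<bullet> (X *v v))"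
    by (subst sum.reindex) (auto simp: inj_on_def axis_eq_axis)
  finally have "c * (A * (c * (\<Sum>i\<in>-J. (w $ i)\<^sup>2)) + m) + (real k - 1) * b * m
      \<le> (\<Sum>v\<in>insert v ?B'. v \<bullet> (X *v v))"
    using vB qv by simp
  also have "\<dots> \<le> P_plus k X"
  proof (rule ky_fan_P_plus[OF anisotropic_symmetric J(2) anisotropic_card_le])
    show "card (insert v ?B') = k"
      using vB orthonormal_axes(1)[of J'] J'(2) by simp
    show "pairwise orthogonal (insert v ?B')"
      using orthonormal_axes(2)[of J'] ov by (auto simp: pairwise_insert orthogonal_def inner_commute)
  qed (use nv in \<open>auto simp: norm_eq_1 inner_axis_axis\<close>)
  finally show ?thesis .
qed

end

lemma profile_derivatives:
  fixes a s t eps :: real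
  assumes "0 \<le> s"
  shows "((\<lambda>s. t * ((1 + s) powr (- a / 2) - eps)) has_real_derivative
      - t * a / 2 * (1 + s) powr (- a / 2 - 1)) (at s)"
    and "((\<lambda>s. - t * a / 2 * (1 + s) powr (- a / 2 - 1)) has_real_derivative
      t * a * (a + 2) / 4 * (1 + s) powr (- a / 2 - 2)) (at s)"
  using assms by (auto intro!: derivative_eq_intros simp: field_simps)

text \<open>
  Let \<open>Y\<close> and \<open>Z\<close> be the parts of \<open>s = \<sigma> x\<close> coming from \<open>J\<close> and from the other directions. The
  constant \<open>1 / t\<close> is the maximum of the quotient of the profile by \<open>u\<close> over the set where the profile
  is nonnegative, a compact subset of the half-space by the bound \<open>s < c\<close> there. At the touching
  point the test function has a negative eigenvalue sum, so both frames have negative trace: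
  the tangential frame gives \<open>(a + 2) Y / (1 + s) < k\<close>, and the mixed one,
  which exists if \<open>Z \<noteq> 0\<close>, gives \<open>(a + 2) Z / (1 + s) < 1 + (k - 1) b / c \<le> 1 + eta\<close>. Since \<open>a + 2 = k + 1 + 2 eta\<close>, adding the two
  bounds \<open>s\<close> by a number that does not depend on \<open>b\<close>, \<open>c\<close> and \<open>eps\<close>. This is the step where
  \<open>a > k - 1\<close> enters. The last conclusion is the tangential trace once more, now weighed against
  \<open>u x powr p\<close>.
\<close>

lemma supersolution_touched_by_profile:
  fixes l :: "'n::finite" and J :: "'n set" and u :: "real ^ 'n \<Rightarrow> real"
  assumes u: "positive_viscosity_supersolution l k p u"
    and J: "l \<notin> J" "card J = k" "0 < k"
    and a: "0 < a" "0 < eta" "a + 2 = real k + 1 + 2 * eta"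
    and bc: "0 < b" "0 < c" "(real k - 1) * b \<le> eta * c"
    and eps: "0 < eps" "eps < 1" "\<And>s. 0 \<le> s \<Longrightarrow> eps \<le> (1 + s) powr (- a / 2) \<Longrightarrow> s < c"
  defines "\<sigma> \<equiv> weighted_sq_dist (\<lambda>i. if i \<in> J then b else c) (axis l 1)"
  obtains t x where "0 < t" "x \<in> half_space l" "eta * \<sigma> x < a + 2"
    "u x = t * ((1 + \<sigma> x) powr (- a / 2) - eps)"
    "\<And>y. y \<in> half_space l \<Longrightarrow> t * ((1 + \<sigma> y) powr (- a / 2) - eps) \<le> u y"
    "u x powr p \<le> t * (real k * a * b)"
proof -
  define d where "d i = (if i \<in> J then b else c)" for i
  let ?e = "axis l 1 :: real ^ 'n"
  have \<sigma>: "\<sigma> = weighted_sq_dist d ?e" by (simp add: \<sigma>_def d_def[abs_def])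
  have d: "0 < d i" for i using bc by (simp add: d_def)
  then have d0: "0 \<le> d i" for i by (simp add: less_imp_le)
  have \<sigma>0: "0 \<le> \<sigma> x" for x unfolding \<sigma> by (rule weighted_sq_dist_nonneg[OF d0])
  have \<sigma>_cont: "continuous_on S \<sigma>" for S unfolding \<sigma> by (rule continuous_on_weighted_sq_dist)
  have upos: "0 < u x" if "x \<in> half_space l" for x
    using u that by (auto simp: positive_viscosity_supersolution_def)
  have lsc: "lower_semicontinuous_on (half_space l) u"
    using u by (auto simp: positive_viscosity_supersolution_def)
  define f where "f x = (1 + \<sigma> x) powr (- a / 2) - eps" for x
  have f_cont: "continuous_on S f" for S
    unfolding f_def using \<sigma>0 by (intro continuous_intros \<sigma>_cont) (metis add_nonneg_eq_0_iff zero_le_one zero_neq_one)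
  define K where "K = {x. 0 \<le> f x}"
  have \<sigma>K: "\<sigma> x < c" if "x \<in> K" for x
    using that \<sigma>0[of x] eps(3)[of "\<sigma> x"] by (auto simp: K_def f_def)
  have term_le: "d i * (x $ i - ?e $ i)\<^sup>2 \<le> \<sigma> x" for i x
    unfolding \<sigma> weighted_sq_dist_def
    by (rule member_le_sum) (auto simp: d0)
  \<comment> \<open>The weight \<open>c\<close> on the \<open>l\<close>-th coordinate confines \<open>K\<close> to \<open>0 < x $ l < 2\<close>.\<close>
  have KH: "x \<in> half_space l" if "x \<in> K" for x
  proof -
    have "c * (x $ l - 1)\<^sup>2 < c * 1"
      using term_le[of l x] \<sigma>K[OF that] J(1) by (simp add: d_def axis_def)
    then have "(x $ l - 1)\<^sup>2 < 1" using bc by simp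
    then have "\<bar>x $ l - 1\<bar> < 1" by (simp add: abs_square_less_1)
    then show ?thesis by (simp add: half_space_def)
  qed
  have "compact K"
    unfolding compact_eq_bounded_closed
  proof
    show "closed K" unfolding K_def by (intro closed_Collect_le continuous_intros f_cont)
    have "norm (x - ?e) \<le> (\<Sum>i\<in>UNIV. sqrt (c / d i))" if "x \<in> K" for x
    proof -
      have "norm (x - ?e) \<le> (\<Sum>i\<in>UNIV. \<bar>(x - ?e) $ i\<bar>)" by (rule norm_le_l1_cart)
      also have "\<dots> \<le> (\<Sum>i\<in>UNIV. sqrt (c / d i))"
      proof (rule sum_mono)
        fix i
        have "(x $ i - ?e $ i)\<^sup>2 * d i \<le> c"
          using term_le[of i x] \<sigma>K[OF that] by (simp add: mult.commute)
        then have "(x $ i - ?e $ i)\<^sup>2 \<le> c / d i" by (simp add: pos_le_divide_eq d)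
        then have "sqrt ((x $ i - ?e $ i)\<^sup>2) \<le> sqrt (c / d i)" by (rule real_sqrt_le_mono)
        then show "\<bar>(x - ?e) $ i\<bar> \<le> sqrt (c / d i)" by simp
      qed
      finally show ?thesis .
    qed
    then have "K \<subseteq> cball ?e (\<Sum>i\<in>UNIV. sqrt (c / d i))"
      by (auto simp: dist_norm norm_minus_commute)
    then show "bounded K" by (rule bounded_subset[OF bounded_cball])
  qed
  have "\<sigma> ?e = 0" by (simp add: \<sigma> weighted_sq_dist_def)
  then have fe: "0 < f ?e" using eps by (simp add: f_def)
  then have eK: "?e \<in> K" by (simp add: K_def)
  obtain x where x: "x \<in> K" "\<And>y. y \<in> K \<Longrightarrow> f y / u y \<le> f x / u x"
    using continuous_over_lower_semicontinuous_attains_max[OF \<open>compact K\<close> _ _ lsc upos f_cont]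
      eK KH by (metis (no_types, lifting) K_def empty_iff mem_Collect_eq subsetI)
  have xH: "x \<in> half_space l" and ux: "0 < u x" using x KH upos by auto
  have "0 < f ?e / u ?e" using fe upos KH eK by simp
  then have "0 < f x / u x" using x(2)[OF eK] by linarith
  then have fx: "0 < f x" using ux by (simp add: zero_less_divide_iff)
  define t where "t = u x / f x"
  have t: "0 < t" "u x = t * f x" using fx ux by (auto simp: t_def)
  have below: "t * f y \<le> u y" if "y \<in> half_space l" for y
  proof (cases "y \<in> K")
    case True
    then have "f y / u y \<le> f x / u x" by (rule x)
    then show ?thesis using upos[OF that] ux fx by (simp add: t_def field_simps)
  next
    case False
    then have "t * f y \<le> 0" using t by (simp add: K_def mult_le_0_iff)
    then show ?thesis using upos[OF that] by simp
  qed
  define G where "G s = t * ((1 + s) powr (- a / 2) - eps)" for s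
  define G' where "G' s = - t * a / 2 * (1 + s) powr (- a / 2 - 1)" for s
  define G'' where "G'' s = t * a * (a + 2) / 4 * (1 + s) powr (- a / 2 - 2)" for s
  have G1: "(G has_real_derivative G' s) (at s)" if "0 \<le> s" for s
    using profile_derivatives(1)[OF that] by (simp add: G_def[abs_def] G'_def)
  have G2: "(G' has_real_derivative G'' s) (at s)" if "0 \<le> s" for s
    using profile_derivatives(2)[OF that] by (simp add: G'_def[abs_def] G''_def)
  have G3: "continuous_on {0..} G''"
    unfolding G''_def by (intro continuous_intros) auto
  define \<phi> where "\<phi> y = G (\<sigma> y)" for y
  have \<phi>f: "\<phi> y = t * f y" for y by (simp add: \<phi>_def G_def f_def)
  have "C2_on (half_space l) \<phi>"
    unfolding \<phi>_def[abs_def] \<sigma> by (rule C2_on_weighted_profile[OF d0 G1 G2 G3])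
  moreover have "local_min_on (half_space l) (\<lambda>y. u y - \<phi> y) x"
    unfolding local_min_on_def using below t(2)
    by (auto simp: \<phi>f eventually_at_filter intro!: always_eventually)
  ultimately have P: "P_plus k (hessian \<phi> x) + u x powr p \<le> 0"
    using u xH unfolding positive_viscosity_supersolution_def by blast
  define s where "s = \<sigma> x"
  have s0: "0 \<le> s" using \<sigma>0 by (simp add: s_def)
  define w where "w = x - ?e"
  define A where "A = 4 * G'' s"
  define m where "m = 2 * G' s"
  have H: "hessian \<phi> x = (\<chi> i j. A * (d i * w $ i) * (d j * w $ j) + (if i = j then d i * m else 0))"
  proof -
    have "hessian (\<lambda>y. G (weighted_sq_dist d ?e y)) = (\<lambda>x. \<chi> i j.
        4 * G'' (weighted_sq_dist d ?e x) * (d i * (x $ i - ?e $ i)) * (d j * (x $ j - ?e $ j)) +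
        (if i = j then 2 * d i * G' (weighted_sq_dist d ?e x) else 0))"
      by (rule hessian_weighted_profile) (use d0 G1 G2 in auto)
    then show ?thesis
      by (simp add: \<phi>_def[abs_def] A_def m_def s_def \<sigma> w_def mult_ac cong: if_cong)
  qed
  define q where "q = t * a * (1 + s) powr (- a / 2 - 1)"
  have m: "m = - q" by (simp add: m_def G'_def q_def)
  have q0: "0 < q" using t a s0 by (simp add: q_def)
  have A: "A = q * (a + 2) / (1 + s)"
  proof -
    have "- a / 2 - 2 = (- a / 2 - 1) - 1" by simp
    then have "(1 + s) powr (- a / 2 - 2) = (1 + s) powr ((- a / 2 - 1) - 1)" by (rule arg_cong)
    also have "\<dots> = (1 + s) powr (- a / 2 - 1) / (1 + s)"
      using s0 by (subst powr_diff) simp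
    finally have "(1 + s) powr (- a / 2 - 2) = (1 + s) powr (- a / 2 - 1) / (1 + s)" .
    moreover have "A = t * a * (a + 2) * (1 + s) powr (- a / 2 - 2)" by (simp add: A_def G''_def)
    ultimately show ?thesis by (simp add: q_def mult_ac)
  qed
  have A0: "0 \<le> A" using A q0 a s0 by simp
  define Y where "Y = b * (\<Sum>i\<in>J. (w $ i)\<^sup>2)"
  define Z where "Z = c * (\<Sum>i\<in>-J. (w $ i)\<^sup>2)"
  have Y0: "0 \<le> Y" and Z0: "0 \<le> Z" using bc by (auto simp: Y_def Z_def sum_nonneg)
  have sYZ: "s = Y + Z"
  proof -
    have "s = (\<Sum>i\<in>J. d i * (w $ i)\<^sup>2) + (\<Sum>i\<in>-J. d i * (w $ i)\<^sup>2)"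
      unfolding s_def \<sigma> weighted_sq_dist_def w_def vector_minus_component
      by (subst sum.union_disjoint[symmetric]) (auto intro: sum.cong)
    then show ?thesis by (simp add: Y_def Z_def d_def sum_distrib_left)
  qed
  have frameY: "b * (A * Y + k * m) \<le> P_plus k (hessian \<phi> x)"
    using P_plus_ge_tangential_frame[OF J(2,3) A0, where b = b and c = c and w = w and m = m] bc
    unfolding H Y_def d_def by simp
  have frameZ: "c * (A * Z + m) + (real k - 1) * b * m \<le> P_plus k (hessian \<phi> x)" if "0 < Z"
  proof -
    have "0 < (\<Sum>i\<in>-J. (w $ i)\<^sup>2)" using that bc by (simp add: Z_def zero_less_mult_iff)
    then show ?thesis
      using P_plus_ge_mixed_frame[OF J(2,3) A0, where b = b and c = c and w = w and m = m] bc
      unfolding H Z_def d_def by simp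
  qed
  have up: "0 < u x powr p" using ux by simp
  then have Pneg: "P_plus k (hessian \<phi> x) < 0" using P by linarith
  have "b * (A * Y + k * m) < 0" using frameY Pneg by linarith
  then have "A * Y < k * q" using bc m by (simp add: mult_less_0_iff)
  then have "q * ((a + 2) * Y / (1 + s)) < q * k" by (simp add: A mult_ac)
  then have 1: "(a + 2) * Y / (1 + s) < k" by (rule mult_left_less_imp_less) (use q0 in simp)
  have "(a + 2) * Z / (1 + s) < 1 + eta"
  proof (cases "0 < Z")
    case True
    then have "c * (A * Z + m) + (real k - 1) * b * m < 0" using frameZ Pneg by force
    then have "c * (A * Z) < q * (c + (real k - 1) * b)" by (simp add: m algebra_simps)
    also have "\<dots> \<le> q * (c + eta * c)" using bc q0 by simp
    finally have "(c * q) * ((a + 2) * Z / (1 + s)) < (c * q) * (1 + eta)"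
      by (simp add: A algebra_simps)
    then show ?thesis by (rule mult_left_less_imp_less) (use bc q0 in simp)
  next
    case False
    then have "Z = 0" using Z0 by simp
    then show ?thesis using a by simp
  qed
  then have "(a + 2) * Y / (1 + s) + (a + 2) * Z / (1 + s) < k + (1 + eta)" using 1 by linarith
  moreover have "(a + 2) * s / (1 + s) = (a + 2) * Y / (1 + s) + (a + 2) * Z / (1 + s)"
    by (simp only: sYZ distrib_left add_divide_distrib)
  ultimately have "(a + 2) * s / (1 + s) < a + 2 - eta" using a(3) by linarith
  then have "(a + 2) * s < (a + 2 - eta) * (1 + s)" using s0 by (simp add: pos_divide_less_eq)
  then have fin1: "eta * s < a + 2" using a by (simp add: algebra_simps)
  have "- (b * (k * m)) \<ge> u x powr p"
  proof -
    have "b * (k * m) \<le> b * (A * Y + k * m)" using bc A0 Y0 by simp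
    then show ?thesis using frameY P by linarith
  qed
  also have "- (b * (k * m)) = b * k * q" by (simp add: m)
  also have "q \<le> t * a"
  proof -
    have "(1 + s) powr (- a / 2 - 1) \<le> (1 + s) powr 0"
      using s0 a by (intro powr_mono) auto
    then show ?thesis using t a s0 by (simp add: q_def)
  qed
  then have "b * k * q \<le> b * k * (t * a)" using bc by (intro mult_left_mono) auto
  finally have fin2: "u x powr p \<le> t * (real k * a * b)" by (simp add: mult_ac)
  show thesis
    by (rule that[OF t(1) xH]) (use fin1 fin2 t below in \<open>auto simp: s_def f_def\<close>)
qed

section \<open>Nonexistence\<close>

text \<open>
  For \<open>p > 1\<close> and \<open>k > 1\<close> the two constraints on \<open>a\<close> are compatible exactly when
  \<open>(k - 1) (p - 1) < 2\<close>, which rewrites to \<open>p < (k + 1) / (k - 1)\<close>.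
\<close>

lemma subcritical_decay_exponent:
  fixes p :: real and k :: nat
  assumes "0 < k" "k = 1 \<or> (k > 1 \<and> p < (real k + 1) / (real k - 1))"
  obtains a where "0 < a" "real k - 1 < a" "a * (p - 1) < 2"
proof (cases "p \<le> 1")
  case True
  then have "real k * (p - 1) \<le> 0" by (simp add: mult_le_0_iff)
  then show ?thesis using that[of "real k"] assms(1) by simp
next
  case False
  define a where "a = ((real k - 1) + 2 / (p - 1)) / 2"
  have "(real k - 1) * (p - 1) < 2"
    using assms(2)
  proof
    assume "k > 1 \<and> p < (real k + 1) / (real k - 1)"
    then have "0 < real k - 1" "p < (real k + 1) / (real k - 1)" by auto
    then have "p * (real k - 1) < real k + 1" by (simp only: pos_less_divide_eq)
    then show ?thesis by (simp add: algebra_simps)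
  qed simp
  then have "real k - 1 < 2 / (p - 1)" using False by (simp add: pos_less_divide_eq)
  then have "real k - 1 < a" "a < 2 / (p - 1)" by (auto simp: a_def)
  moreover then have "a * (p - 1) < 2" using False by (simp add: pos_less_divide_eq)
  moreover have "0 \<le> real k - 1" using assms(1) by simp
  ultimately show ?thesis using that[of a] by linarith
qed

lemma no_bound_by_small_powers:
  fixes K M r :: real
  assumes "0 < r" "0 < M" "\<And>b. 0 < b \<Longrightarrow> b \<le> 1 \<Longrightarrow> K \<le> M * b powr r"
  shows "K \<le> 0"
proof (rule ccontr)
  assume "\<not> K \<le> 0"
  then have K: "0 < K" by simp
  define b where "b = min 1 ((K / (2 * M)) powr (1 / r))"
  have b: "0 < b" "b \<le> 1" using K assms by (auto simp: b_def)
  have "b powr r \<le> ((K / (2 * M)) powr (1 / r)) powr r"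
    using b assms by (intro powr_mono2) (auto simp: b_def)
  also have "\<dots> = K / (2 * M)" using K assms by (simp add: powr_powr)
  finally have "M * b powr r \<le> K / 2" using assms by (simp add: field_simps)
  then show False using assms(3)[OF b] K by linarith
qed

lemma profile_superlevel_bound:
  fixes a eps s c :: real
  assumes "0 < a" "0 < eps" "eps powr (- 2 / a) \<le> c" "0 \<le> s" "eps \<le> (1 + s) powr (- a / 2)"
  shows "s < c"
proof (rule ccontr)
  assume "\<not> s < c"
  then have "eps powr (- 2 / a) < 1 + s" using assms by linarith
  then have "(1 + s) powr (- a / 2) < (eps powr (- 2 / a)) powr (- a / 2)"
    using assms by (intro powr_less_mono2_neg) auto
  also have "\<dots> = eps" using assms by (simp add: powr_powr)
  finally show False using assms by simp
qed

lemma lower_semicontinuous_positive_lower_bound: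
  fixes u :: "'a::metric_space \<Rightarrow> real"
  assumes "compact K" "K \<subseteq> S" "lower_semicontinuous_on S u" "\<And>x. x \<in> S \<Longrightarrow> 0 < u x"
  obtains m where "0 < m" "\<And>x. x \<in> K \<Longrightarrow> m \<le> u x"
proof (cases "K = {}")
  case True
  then show ?thesis using that[of 1] by simp
next
  case False
  then obtain x where x: "x \<in> K" "\<And>y. y \<in> K \<Longrightarrow> 1 / u y \<le> 1 / u x"
    using continuous_over_lower_semicontinuous_attains_max[OF assms(1) _ assms(2-4), of "\<lambda>_. 1"] by auto
  have "u x \<le> u y" if "y \<in> K" for y
  proof -
    have "0 < u x" "0 < u y" using x(1) that assms(2,4) by auto
    then show ?thesis using x(2)[OF that] by (simp add: field_simps)
  qed
  then show ?thesis using that[of "u x"] x(1) assms(2,4) by auto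
qed

theorem theorem1p5:
  fixes l :: "'n::finite" and k :: nat and p :: real
  assumes "0 < k" and "k < CARD('n)" and "p > 0"
    and "k = 1 \<or> (k > 1 \<and> p < (real k + 1) / (real k - 1))"
  shows "\<not> (\<exists>u :: real ^ 'n \<Rightarrow> real. positive_viscosity_supersolution l k p u)"
proof
  assume "\<exists>u :: real ^ 'n \<Rightarrow> real. positive_viscosity_supersolution l k p u"
  then obtain u :: "real ^ 'n \<Rightarrow> real" where u: "positive_viscosity_supersolution l k p u" by blast
  have upos: "0 < u x" if "x \<in> half_space l" for x
    using u that by (auto simp: positive_viscosity_supersolution_def)
  have lsc: "lower_semicontinuous_on (half_space l) u"
    using u by (auto simp: positive_viscosity_supersolution_def)
  have "k \<le> card (- {l})" using assms(2) by (simp add: card_Diff_singleton Compl_eq_Diff_UNIV)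
  \<comment> \<open>The directions in \<open>J\<close> are parallel to the boundary, so the test function may spread along them.\<close>
  then obtain J where "J \<subseteq> - {l}" and Jk: "card J = k"
    using obtain_subset_with_card_n by blast
  then have J: "l \<notin> J" by auto
  obtain a where a: "0 < a" "real k - 1 < a" "a * (p - 1) < 2"
    using subcritical_decay_exponent[OF assms(1,4)] by blast
  define eta where "eta = (a + 1 - real k) / 2"
  have eta: "0 < eta" "a + 2 = real k + 1 + 2 * eta" using a by (auto simp: eta_def field_simps)
  define S where "S = (a + 2) / eta"
  have S: "0 < S" using a eta by (simp add: S_def)
  have less_S: "s < S" if "eta * s < a + 2" for s
    using that eta by (simp add: S_def pos_less_divide_eq mult.commute)
  let ?e = "axis l 1 :: real ^ 'n"
  have e: "?e \<in> half_space l" by (simp add: half_space_def)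
  define g where "g s = (1 + s) powr (- a / 2)" for s :: real
  have g_pos: "0 < g s" if "0 \<le> s" for s using that by (simp add: g_def)
  have g_mono: "g s' \<le> g s" if "0 \<le> s" "s \<le> s'" for s s'
    unfolding g_def using that a by (intro powr_mono2') auto
  have g0: "g 0 = 1" by (simp add: g_def)
  define gam where "gam = g S / 2"
  have gam: "0 < gam" "gam \<le> 1 / 2" using g_pos[of S] g_mono[of 0 S] S g0 by (auto simp: gam_def)
  define \<sigma> where "\<sigma> b c = weighted_sq_dist (\<lambda>i. if i \<in> J then b else c) ?e" for b c
  have \<sigma>_nonneg: "0 \<le> \<sigma> b c x" if "0 < b" "0 < c" for b c x
    unfolding \<sigma>_def using that by (intro weighted_sq_dist_nonneg) auto
  \<comment> \<open>\<open>mu\<close> bounds the touching height at scale \<open>b = 1\<close> from below, for all \<open>eps\<close> and all \<open>c \<ge> max 1 (4 S)\<close>.\<close>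
  obtain mu where mu: "0 < mu" "\<And>x. norm (x - ?e) \<le> sqrt S \<Longrightarrow> 1 / 2 \<le> x $ l \<Longrightarrow> mu \<le> u x"
  proof -
    let ?K = "cball ?e (sqrt S) \<inter> {x. 1 / 2 \<le> x $ l}"
    have "compact ?K" by (intro compact_Int_closed closed_Collect_le continuous_intros) auto
    moreover have "?K \<subseteq> half_space l" by (auto simp: half_space_def)
    ultimately obtain m where "0 < m" "\<And>x. x \<in> ?K \<Longrightarrow> m \<le> u x"
      using lower_semicontinuous_positive_lower_bound lsc upos by metis
    then show thesis using that[of m] by (auto simp: dist_norm norm_minus_commute)
  qed
  define C where "C = real k * a * gam powr (- p)"
  have C: "0 < C" using assms(1) a gam by (simp add: C_def)
  \<comment> \<open>The first bound on \<open>t\<close> compares at \<open>axis l 1\<close>, the second is the equation at the touching point,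
    and the third compares there with the test function touching at scale \<open>1\<close>.\<close>
  have touch: "\<exists>t>0. t \<le> 2 * u ?e \<and> t powr (p - 1) \<le> C * b \<and>
      t \<ge> mu * (g (S + S / b) / 2)"
    if b: "0 < b" "b \<le> 1" for b
  proof -
    \<comment> \<open>The touching point \<open>x\<close> at scale \<open>b\<close> satisfies \<open>\<sigma> 1 c x \<le> S + S / b\<close>; this choice keeps the
      truncated profile at scale \<open>1\<close> at least \<open>eps\<close> there.\<close>
    define eps where "eps = g (S + S / b) / 2"
    have SSb: "0 \<le> S / b" using S b by simp
    have eps: "0 < eps" "eps \<le> gam"
      using S SSb g_pos[of "S + S / b"] g_mono[of S "S + S / b"] by (auto simp: eps_def gam_def)
    \<comment> \<open>One \<open>c\<close> serves both scales, so that the two test functions can be compared at \<open>x\<close>.\<close>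
    define c where "c = 1 + eps powr (- 2 / a) + 4 * S + (real k - 1) / eta"
    have "0 \<le> (real k - 1) / eta" using assms(1) eta by simp
    then have c: "1 \<le> c" "4 * S \<le> c" "eps powr (- 2 / a) \<le> c" "(real k - 1) / eta \<le> c"
      unfolding c_def using S by (smt (verit) powr_ge_zero)+
    then have kc: "(real k - 1) * 1 \<le> eta * c" using eta by (simp add: pos_divide_le_eq mult.commute)
    have kbc: "(real k - 1) * b \<le> eta * c"
      using mult_left_mono[OF b(2), of "real k - 1"] kc assms(1) by simp
    have far: "s < c" if "0 \<le> s" "eps \<le> (1 + s) powr (- a / 2)" for s
      using profile_superlevel_bound[OF a(1) eps(1) c(3)] that by blast
    have far': "s < c" if "0 \<le> s" "gam \<le> (1 + s) powr (- a / 2)" for s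
      using far that eps by simp
    have c0: "0 < c" using c by simp
    obtain t x where t: "0 < t" and x: "x \<in> half_space l" "eta * \<sigma> b c x < a + 2"
      and ux: "u x = t * (g (\<sigma> b c x) - gam)"
      and below: "\<And>y. y \<in> half_space l \<Longrightarrow> t * (g (\<sigma> b c y) - gam) \<le> u y"
      and up: "u x powr p \<le> t * (real k * a * b)"
      unfolding \<sigma>_def g_def
      by (rule supersolution_touched_by_profile[OF u J Jk assms(1) a(1) eta b(1) c0 kbc gam(1) _ far'])
        (use gam in auto)
    obtain t1 x1 where t1: "0 < t1" and x1: "x1 \<in> half_space l" "eta * \<sigma> 1 c x1 < a + 2"
      and ux1: "u x1 = t1 * (g (\<sigma> 1 c x1) - eps)"
      and below1: "\<And>y. y \<in> half_space l \<Longrightarrow> t1 * (g (\<sigma> 1 c y) - eps) \<le> u y"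
      unfolding \<sigma>_def g_def
      by (rule supersolution_touched_by_profile[OF u J Jk assms(1) a(1) eta zero_less_one c0 kc eps(1) _ far])
        (use gam eps in auto)
    have sx: "0 \<le> \<sigma> b c x" "\<sigma> b c x < S" using \<sigma>_nonneg b c0 x less_S by auto
    have sx1: "0 \<le> \<sigma> 1 c x1" "\<sigma> 1 c x1 < S" using \<sigma>_nonneg c0 x1 less_S by auto
    have "\<sigma> b c ?e = 0" by (simp add: \<sigma>_def weighted_sq_dist_def)
    then have "t * (1 - gam) \<le> u ?e" using below[OF e] g0 by simp
    moreover have "t * (1 / 2) \<le> t * (1 - gam)" using t gam by (intro mult_left_mono) auto
    ultimately have tle: "t \<le> 2 * u ?e" by linarith
    have "t * gam \<le> u x"
      unfolding ux using t g_mono[of "\<sigma> b c x" S] sx by (auto simp: gam_def)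
    then have "(t * gam) powr p \<le> t * (real k * a * b)"
      using powr_mono2[of p "t * gam" "u x"] up t gam assms(3) by simp
    then have "t powr p * gam powr p \<le> t * (real k * a * b)" using t gam by (simp add: powr_mult)
    then have "t powr p / t * gam powr p \<le> real k * a * b"
      using t by (simp add: divide_le_eq mult_ac)
    then have "t powr (p - 1) \<le> real k * a * b / gam powr p"
      using t gam by (simp add: powr_diff pos_le_divide_eq)
    then have tpow: "t powr (p - 1) \<le> C * b" by (simp add: C_def powr_minus field_simps)
    have "mu \<le> u x1"
    proof (rule mu(2))
      have "(norm (x1 - ?e))\<^sup>2 = (\<Sum>i\<in>UNIV. (x1 $ i - ?e $ i)\<^sup>2)"
        by (simp add: power2_norm_eq_inner inner_vec_def flip: power2_eq_square)
      also have "\<dots> \<le> \<sigma> 1 c x1"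
        unfolding \<sigma>_def weighted_sq_dist_def using c(1)
        by (intro sum_mono) (auto simp: mult_le_cancel_right1)
      finally have "(norm (x1 - ?e))\<^sup>2 \<le> S" using sx1 by simp
      then show "norm (x1 - ?e) \<le> sqrt S" by (rule real_le_rsqrt)
      have "c * (x1 $ l - 1)\<^sup>2 = (if l \<in> J then 1 else c) * (x1 $ l - ?e $ l)\<^sup>2"
        using J by simp
      also have "\<dots> \<le> \<sigma> 1 c x1"
        unfolding \<sigma>_def weighted_sq_dist_def using c(1) by (intro member_le_sum) auto
      also have "\<dots> \<le> c * (1 / 4)" using sx1 c by simp
      finally have "(x1 $ l - 1)\<^sup>2 \<le> 1 / 4" using c0 by (rule mult_left_le_imp_le)
      then have "(x1 $ l - 1)\<^sup>2 \<le> (1 / 2)\<^sup>2" by (simp add: power2_eq_square)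
      then have "\<bar>x1 $ l - 1\<bar> \<le> 1 / 2" by (simp add: abs_le_square_iff[symmetric])
      then show "1 / 2 \<le> x1 $ l" by linarith
    qed
    also have "\<dots> \<le> t1"
    proof -
      have "g (\<sigma> 1 c x1) - eps \<le> 1" using g_mono[of 0 "\<sigma> 1 c x1"] sx1 g0 eps by simp
      then show ?thesis unfolding ux1 using t1 by (simp add: mult_left_le)
    qed
    finally have mut1: "mu \<le> t1" .
    have "\<sigma> 1 c x \<le> S + S / b"
    proof -
      have "\<sigma> 1 c x \<le> \<sigma> b c x / b"
        unfolding \<sigma>_def weighted_sq_dist_def sum_divide_distrib using b c0
        by (intro sum_mono) (auto simp: field_simps intro!: mult_left_le_one_le)
      also have "\<dots> \<le> S / b" using sx b by (intro divide_right_mono) auto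
      finally show ?thesis using S by simp
    qed
    then have "2 * eps \<le> g (\<sigma> 1 c x)"
      using g_mono[of "\<sigma> 1 c x" "S + S / b"] \<sigma>_nonneg c0 by (simp add: eps_def)
    then have "mu * eps \<le> t1 * (g (\<sigma> 1 c x) - eps)"
      using mut1 mu(1) t1 eps by (intro mult_mono) auto
    also have "\<dots> \<le> u x" by (rule below1[OF x(1)])
    also have "\<dots> \<le> t"
    proof -
      have "g (\<sigma> b c x) - gam \<le> 1" using g_mono[of 0 "\<sigma> b c x"] sx g0 gam by simp
      then show ?thesis unfolding ux using t by (simp add: mult_left_le)
    qed
    finally show ?thesis using t tle tpow by (auto simp: eps_def)
  qed
  show False
  proof (cases "p \<le> 1")
    case True
    have "(2 * u ?e) powr (p - 1) \<le> C * b powr 1" if b: "0 < b" "b \<le> 1" for b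
    proof -
      obtain t where t: "0 < t" "t \<le> 2 * u ?e" "t powr (p - 1) \<le> C * b" using touch[OF b] by blast
      have "(2 * u ?e) powr (p - 1) \<le> t powr (p - 1)" using t True by (intro powr_mono2') auto
      then show ?thesis using t b by simp
    qed
    then have "(2 * u ?e) powr (p - 1) \<le> 0" using no_bound_by_small_powers[OF zero_less_one C] by blast
    then show False using upos[OF e] by simp
  next
    case False
    define M where "M = mu * (1 + 2 * S) powr (- a / 2) / 2"
    have M: "0 < M" using mu S by (simp add: M_def)
    define r where "r = 1 - a * (p - 1) / 2"
    have r: "0 < r" using a by (simp add: r_def)
    have "M powr (p - 1) \<le> C * b powr r" if b: "0 < b" "b \<le> 1" for b
    proof -
      obtain t where t: "0 < t" "mu * (g (S + S / b) / 2) \<le> t" "t powr (p - 1) \<le> C * b"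
        using touch[OF b] by blast
      have "1 + (S + S / b) \<le> (1 + 2 * S) * (1 / b)"
      proof -
        have "1 \<le> 1 / b" using b by simp
        moreover then have "S * 1 \<le> S * (1 / b)" using S by (intro mult_left_mono) auto
        ultimately show ?thesis by (simp add: add_divide_distrib)
      qed
      then have "((1 + 2 * S) * (1 / b)) powr (- a / 2) \<le> g (S + S / b)"
        unfolding g_def using a b S by (intro powr_mono2') (auto intro!: add_pos_nonneg)
      moreover have "((1 + 2 * S) * (1 / b)) powr (- a / 2) = (1 + 2 * S) powr (- a / 2) * b powr (a / 2)"
        using b S by (subst powr_mult) (auto simp: powr_divide powr_minus field_simps)
      ultimately have "M * b powr (a / 2) \<le> mu * (g (S + S / b) / 2)"
        using mu by (simp add: M_def)
      then have "M * b powr (a / 2) \<le> t" using t by linarith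
      then have "(M * b powr (a / 2)) powr (p - 1) \<le> C * b"
        using powr_mono2[of "p - 1" "M * b powr (a / 2)" t] t M False by simp
      then have "M powr (p - 1) * b powr (a * (p - 1) / 2) \<le> C * b"
        using M b by (simp add: powr_mult powr_powr)
      then have "M powr (p - 1) \<le> C * (b powr 1 / b powr (a * (p - 1) / 2))"
        using b by (simp add: field_simps)
      then show ?thesis by (simp add: r_def powr_diff)
    qed
    then have "M powr (p - 1) \<le> 0" using no_bound_by_small_powers[OF r C] by blast
    then show False using M by simp
  qed
qed

end
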